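(* There exists a transcendental entire function $f:\mathbb{C}\to\mathbb{C}$ such that there are uncountably many quasiregular maps $g:\mathbb{C}\to\mathbb{C}$ with $f\circ g=g\circ f$. *)

theory Defs
  imports "HOL-Analysis.Analysis"
begin

definition transcendental_entire :: "(complex \<Rightarrow> complex) \<Rightarrow> bool" where
  "transcendental_entire f \<longleftrightarrow> f holomorphic_on UNIV \<and> \<not> (\<exists>p. \<forall>z. f z = poly p z)"

definition test_fun :: "(complex \<Rightarrow> real) \<Rightarrow> (complex \<Rightarrow> real) \<Rightarrow> (complex \<Rightarrow> real) \<Rightarrow> bool" where
  "test_fun ph phx phy \<longleftrightarrow>
     continuous_on UNIV phx \<and> continuous_on UNIV phy \<and>
     (\<forall>z. (ph has_derivative (\<lambda>h. Re h * phx z + Im h * phy z)) (at z)) \<and>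
     bounded {z. ph z \<noteq> 0}"

definition L2_loc :: "(complex \<Rightarrow> complex) \<Rightarrow> bool" where
  "L2_loc u \<longleftrightarrow> u \<in> borel_measurable lborel \<and>
     (\<forall>K. compact K \<longrightarrow> set_integrable lborel K (\<lambda>z. (cmod (u z))\<^sup>2))"

definition weak_partials :: "(complex \<Rightarrow> complex) \<Rightarrow> (complex \<Rightarrow> complex) \<Rightarrow> (complex \<Rightarrow> complex) \<Rightarrow> bool" where
  "weak_partials g u v \<longleftrightarrow>
     (\<forall>ph phx phy. test_fun ph phx phy \<longrightarrow>
        (LINT z|lborel. of_real (phx z) * g z) = - (LINT z|lborel. of_real (ph z) * u z) \<and>
        (LINT z|lborel. of_real (phy z) * g z) = - (LINT z|lborel. of_real (ph z) * v z))"

text \<open>Quasiregular map of the plane: continuous, in W^{1,2}_loc, and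
  |Dg|^2 \<le> K J_g almost everywhere for some K \<ge> 1, where with
  g_z = (g_x - i g_y)/2, g_zbar = (g_x + i g_y)/2 one has
  |Dg| = |g_z| + |g_zbar| and J_g = |g_z|^2 - |g_zbar|^2.\<close>
definition quasiregular :: "(complex \<Rightarrow> complex) \<Rightarrow> bool" where
  "quasiregular g \<longleftrightarrow> continuous_on UNIV g \<and>
     (\<exists>u v K. K \<ge> 1 \<and> L2_loc u \<and> L2_loc v \<and> weak_partials g u v \<and>
        (AE z in lborel.
           (cmod ((u z - \<i> * v z) / 2) + cmod ((u z + \<i> * v z) / 2))\<^sup>2
             \<le> K * ((cmod ((u z - \<i> * v z) / 2))\<^sup>2 - (cmod ((u z + \<i> * v z) / 2))\<^sup>2)))"

end

theory Submission
  imports Defs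
begin

text \<open>
  Let \<open>f z = exp (z - 5)\<close>. It maps the disc of radius \<open>5/2\<close> injectively into a small part of itself
  (the set \<open>trap\<close>), contracting towards an attracting fixed point. A small deformation \<open>s\<close> of
  the identity, supported in a disc of the fundamental domain between the two sets, is transported
  to a solution of \<open>f \<circ> g = g \<circ> f\<close>: forwards by conjugation, \<open>g (f y) = f (g y)\<close>, and backwards by
  \<open>g z = z + Ln (g (f z) / f z)\<close>. Both operations are conformal, so the dilatation does not change,
  and both contract the relative displacement \<open>k z = (g z - z) / z\<close>, so the distortion along an orbit is
  bounded and the approximations \<open>G n\<close> are uniformly Lipschitz. Hence the limit is quasiregular;
  different seeds give different \<open>g\<close>.

  Derivatives are written as \<open>v \<mapsto> a v + b cnj v\<close>, so that \<open>a = g\<^sub>z\<close> and \<open>b\<close> is the derivative with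
  respect to the conjugate variable.
\<close>

section \<open>Integration by parts for Lipschitz differentiable maps\<close>

lemma lborel_integral_translate:
  fixes F :: "'a::euclidean_space \<Rightarrow> 'b::{banach, second_countable_topology}"
  assumes "F \<in> borel_measurable borel"
  shows "(LINT x|lborel. F (c + x)) = (LINT x|lborel. F x)"
proof -
  have "(LINT x|lborel. F x) = (LINT x|distr lborel borel ((+) c). F x)"
    by (simp add: lborel_distr_plus)
  also have "\<dots> = (LINT x|lborel. F (c + x))"
    by (rule integral_distr) (use assms in auto)
  finally show ?thesis by simp
qed

text \<open>Turns a directional derivative into a sequential limit of functions built from
  \<open>F\<close>. This gives both its measurability and access to dominated convergence. The case
  \<open>e = 0\<close> is separate because the increments must avoid \<open>0\<close>.\<close>

lemma difference_quotient_tendsto: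
  fixes F :: "'a::real_normed_vector \<Rightarrow> 'b::real_normed_vector"
  assumes "(F has_derivative D) (at z)"
  shows "(\<lambda>j. real (Suc j) *\<^sub>R (F ((1 / real (Suc j)) *\<^sub>R e + z) - F z)) \<longlonglongrightarrow> D e"
proof (cases "e = 0")
  case True
  then show ?thesis
    using has_derivative_bounded_linear[OF assms] by (simp add: linear_simps)
next
  case False
  define h where "h j = (1 / real (Suc j)) *\<^sub>R e" for j
  have D: "bounded_linear D" "((\<lambda>h. norm (F (z + h) - F z - D h) / norm h) \<longlongrightarrow> 0) (at 0)"
    using assms by (auto simp: has_derivative_at)
  have "h \<longlonglongrightarrow> 0 *\<^sub>R e"
    unfolding h_def by (intro tendsto_intros LIMSEQ_Suc[OF lim_1_over_n])
  then have "filterlim h (at 0) sequentially"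
    using False by (auto simp: filterlim_at h_def)
  from filterlim_compose[OF D(2) this]
  have "(\<lambda>j. norm (F (z + h j) - F z - D (h j)) / norm (h j) * norm e) \<longlonglongrightarrow> 0 * norm e"
    by (intro tendsto_intros)
  moreover have "norm (F (z + h j) - F z - D (h j)) / norm (h j) * norm e
      = norm (real (Suc j) *\<^sub>R (F (h j + z) - F z) - D e)" for j
  proof -
    have "real (Suc j) *\<^sub>R (F (h j + z) - F z) - D e = real (Suc j) *\<^sub>R (F (z + h j) - F z - D (h j))"
      using D(1) by (simp add: h_def linear_simps scaleR_diff_right add.commute del: of_nat_Suc)
    then show ?thesis using False by (simp add: h_def del: of_nat_Suc)
  qed
  ultimately show ?thesis
    by (simp add: LIM_zero_iff tendsto_norm_zero_iff flip: h_def del: of_nat_Suc)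
qed

text \<open>By translation invariance every difference quotient has integral zero. The Lipschitz
  bound and the bounded support dominate all of them by one multiple of an indicator, so the zero
  passes to the limit.\<close>

lemma integral_derivative_eq_0:
  fixes F :: "'a::euclidean_space \<Rightarrow> 'b::{banach, second_countable_topology}"
  assumes lip: "\<And>x y. norm (F x - F y) \<le> C * norm (x - y)"
    and supp: "\<And>z. norm z > R \<Longrightarrow> F z = 0"
    and der: "\<And>z. (F has_derivative D z) (at z)"
  shows "integrable lborel (\<lambda>z. D z e)" "(LINT z|lborel. D z e) = 0"
proof -
  define s where "s j z = real (Suc j) *\<^sub>R (F ((1 / real (Suc j)) *\<^sub>R e + z) - F z)" for j z
  \<comment> \<open>The increments have norm at most \<open>norm e\<close>, so all difference
    quotients vanish off the ball of radius \<open>R + norm e\<close>.\<close>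
  define w where "w = (\<lambda>z::'a. indicator (cball 0 (R + norm e)) z * (C * norm e))"
  have cont: "continuous_on UNIV F"
    using der by (auto intro!: continuous_at_imp_continuous_on has_derivative_continuous)
  have [measurable]: "F \<in> borel_measurable borel"
    by (rule borel_measurable_continuous_onI[OF cont])
  have [measurable]: "s j \<in> borel_measurable lborel" for j
    unfolding s_def by measurable
  have lim: "(\<lambda>j. s j z) \<longlonglongrightarrow> D z e" for z
    unfolding s_def by (rule difference_quotient_tendsto[OF der])
  have [measurable]: "(\<lambda>z. D z e) \<in> borel_measurable lborel"
    by (rule borel_measurable_LIMSEQ_metric[OF _ lim]) auto
  have iw: "integrable lborel w"
    unfolding w_def
    by (intro integrable_mult_left integrable_real_indicator)
       (simp_all add: emeasure_bounded_finite[unfolded infinity_ennreal_def])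
  have C0: "0 \<le> C * norm e"
    using lip[of e 0] norm_ge_zero[of "F e - F 0"] by (simp del: norm_ge_zero)
  have bd: "norm (s j z) \<le> w z" for j z
  proof (cases "norm z \<le> R + norm e")
    case True
    have "norm (s j z) = real (Suc j) * norm (F ((1 / real (Suc j)) *\<^sub>R e + z) - F z)"
      unfolding s_def by simp
    also have "\<dots> \<le> real (Suc j) * (C * norm ((1 / real (Suc j)) *\<^sub>R e))"
      using lip[of "(1 / real (Suc j)) *\<^sub>R e + z" z] by (intro mult_left_mono) auto
    also have "\<dots> = C * norm e" by simp
    finally show ?thesis using True by (simp add: w_def)
  next
    case False
    have "norm ((1 / real (Suc j)) *\<^sub>R e) \<le> norm e"
      using mult_right_mono[of "1 / real (Suc j)" 1 "norm e"] by (simp add: divide_simps)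
    moreover have "norm z \<le> norm ((1 / real (Suc j)) *\<^sub>R e + z) + norm ((1 / real (Suc j)) *\<^sub>R e)"
      using norm_triangle_ineq4[of "(1 / real (Suc j)) *\<^sub>R e + z" "(1 / real (Suc j)) *\<^sub>R e"] by (simp del: norm_scaleR)
    ultimately have "norm ((1 / real (Suc j)) *\<^sub>R e + z) > R" "norm z > R"
      using False norm_ge_zero[of e] by linarith+
    then show ?thesis using supp C0 by (simp add: s_def w_def indicator_def)
  qed
  have "F = (\<lambda>z. indicator (cball 0 R) z *\<^sub>R F z)"
    using supp by (auto simp: indicator_def fun_eq_iff)
  then have iF: "integrable lborel F"
    using borel_integrable_compact[of "cball 0 R" F] continuous_on_subset[OF cont] by simp
  have "integrable (distr lborel borel ((+) c)) F" for c
    using iF by (simp add: lborel_distr_plus)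
  then have iFc: "integrable lborel (\<lambda>z. F (c + z))" for c
    by (rule integrable_distr[rotated]) auto
  show "integrable lborel (\<lambda>z. D z e)"
    by (rule integrable_dominated_convergence[OF _ _ iw]) (auto intro: lim bd)
  have "(LINT z|lborel. s j z) = 0" for j
    unfolding s_def using iF iFc by (simp add: lborel_integral_translate)
  moreover have "(\<lambda>j. LINT z|lborel. s j z) \<longlonglongrightarrow> (LINT z|lborel. D z e)"
    by (rule integral_dominated_convergence[OF _ _ iw]) (auto intro: lim bd)
  ultimately show "(LINT z|lborel. D z e) = 0"
    by (simp add: LIMSEQ_const_iff)
qed

lemma continuous_vanishing_bounded:
  fixes q :: "complex \<Rightarrow> real"
  assumes "continuous_on UNIV q" and "\<And>z. norm z > R \<Longrightarrow> q z = 0"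
  obtains M where "M \<ge> 0" "\<And>z. \<bar>q z\<bar> \<le> M"
proof -
  have "bounded (q ` cball 0 R)"
    by (intro compact_imp_bounded compact_continuous_image continuous_on_subset[OF assms(1)]) auto
  then obtain M where M: "\<And>z. z \<in> cball 0 R \<Longrightarrow> \<bar>q z\<bar> \<le> M"
    unfolding bounded_iff by (metis imageI real_norm_def)
  have "\<bar>q z\<bar> \<le> max 0 M" for z
    using M[of z] assms(2)[of z] by (cases "norm z \<le> R") auto
  then show thesis by (rule that[rotated]) auto
qed

text \<open>Off a ball containing the support, \<open>ph\<close> is locally zero, so uniqueness of
  the derivative kills \<open>phx\<close> and \<open>phy\<close> there as well. Compactness of the
  ball gives the bounds.\<close>

lemma test_fun_bounds:
  assumes "test_fun ph phx phy"
  obtains R M where "R > 0" "M \<ge> 0"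
    "\<And>z. norm z > R \<Longrightarrow> ph z = 0 \<and> phx z = 0 \<and> phy z = 0"
    "\<And>z. \<bar>ph z\<bar> \<le> M" "\<And>z. \<bar>phx z\<bar> \<le> M" "\<And>z. \<bar>phy z\<bar> \<le> M"
proof -
  have der: "(ph has_derivative (\<lambda>h. Re h * phx z + Im h * phy z)) (at z)" for z
    using assms by (auto simp: test_fun_def)
  have c: "continuous_on UNIV phx" "continuous_on UNIV phy"
    and b: "bounded {z. ph z \<noteq> 0}"
    using assms by (auto simp: test_fun_def)
  obtain R where R: "R > 0" "\<And>z. ph z \<noteq> 0 \<Longrightarrow> norm z \<le> R"
    using b by (auto simp: bounded_pos)
  have 0: "ph z = 0" if "norm z > R" for z
    using R(2)[of z] that by force
  have 1: "phx z = 0 \<and> phy z = 0" if "norm z > R" for z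
  proof -
    have "((\<lambda>z. 0) has_derivative (\<lambda>h. Re h * phx z + Im h * phy z)) (at z)"
      by (rule has_derivative_transform_within_open[OF der, of "- cball 0 R"]) (use that 0 in auto)
    then have "(\<lambda>h. Re h * phx z + Im h * phy z) = (\<lambda>h. 0)"
      by (rule has_derivative_unique) auto
    from fun_cong[OF this, of 1] fun_cong[OF this, of \<i>] show ?thesis by auto
  qed
  have "continuous_on UNIV ph"
    using der by (auto intro!: continuous_at_imp_continuous_on has_derivative_continuous)
  from continuous_vanishing_bounded[OF this 0]
  obtain M1 where M1: "M1 \<ge> 0" "\<And>z. \<bar>ph z\<bar> \<le> M1"
    by blast
  obtain M2 where M2: "M2 \<ge> 0" "\<And>z. \<bar>phx z\<bar> \<le> M2"
    by (rule continuous_vanishing_bounded[OF c(1), of R]) (use 1 in auto)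
  obtain M3 where M3: "M3 \<ge> 0" "\<And>z. \<bar>phy z\<bar> \<le> M3"
    by (rule continuous_vanishing_bounded[OF c(2), of R]) (use 1 in auto)
  show thesis
  proof (rule that[of R "M1 + M2 + M3"])
    fix z
    show "\<bar>ph z\<bar> \<le> M1 + M2 + M3" "\<bar>phx z\<bar> \<le> M1 + M2 + M3" "\<bar>phy z\<bar> \<le> M1 + M2 + M3"
      using M1(1) M2(1) M3(1) M1(2)[of z] M2(2)[of z] M3(2)[of z] by linarith+
  qed (use R M1 M2 M3 0 1 in auto)
qed

lemma lipschitz_of_derivative_bound:
  fixes g :: "'a::{real_normed_vector, perfect_space} \<Rightarrow> 'b::real_normed_vector"
  assumes "\<And>z. (g has_derivative D z) (at z)" "\<And>z v. norm (D z v) \<le> C * norm v"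
  shows "norm (g x - g y) \<le> C * norm (x - y)"
  by (rule differentiable_bound[OF convex_UNIV, of g D]) (auto intro: assms onorm_le)

text \<open>The product of \<open>ph\<close> and \<open>g\<close> is Lipschitz with bounded support,
  so its directional derivative has integral zero, and the product rule splits that integral. The
  directions \<open>1\<close> and \<open>\<i>\<close> yield the two identities of
  \<open>weak_partials\<close>.\<close>

lemma integration_by_parts_test_fun:
  fixes g :: "complex \<Rightarrow> complex"
  assumes tf: "test_fun ph phx phy"
    and der: "\<And>z. (g has_derivative D z) (at z)"
    and bd: "\<And>z v. norm (D z v) \<le> C * norm v"
  shows "(LINT z|lborel. of_real (Re e * phx z + Im e * phy z) * g z)
           = - (LINT z|lborel. of_real (ph z) * D z e)"
proof -
  obtain R M where R: "R > 0" and M: "M \<ge> 0"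
    and out: "\<And>z. norm z > R \<Longrightarrow> ph z = 0 \<and> phx z = 0 \<and> phy z = 0"
    and b: "\<And>z. \<bar>ph z\<bar> \<le> M" "\<And>z. \<bar>phx z\<bar> \<le> M" "\<And>z. \<bar>phy z\<bar> \<le> M"
    using test_fun_bounds[OF tf] by metis
  have dph: "(ph has_derivative (\<lambda>h. Re h * phx z + Im h * phy z)) (at z)" for z
    using tf by (auto simp: test_fun_def)
  have c: "continuous_on UNIV ph" "continuous_on UNIV phx" "continuous_on UNIV phy" "continuous_on UNIV g"
    using tf der dph by (auto simp: test_fun_def intro!: continuous_at_imp_continuous_on has_derivative_continuous)
  have C: "C \<ge> 0"
    using bd[of 0 1] norm_ge_zero[of "D 0 1"] by (simp del: norm_ge_zero)
  define N where "N = norm (g 0) + C * R"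
  have N: "norm (g z) \<le> N" if "norm z \<le> R" for z
  proof -
    have "norm (g z - g 0) \<le> C * norm z"
      using lipschitz_of_derivative_bound[OF der bd, of z 0] by simp
    also have "\<dots> \<le> C * R" using that C by (rule mult_left_mono)
    finally show ?thesis unfolding N_def using norm_triangle_sub[of "g z" "g 0"] by linarith
  qed
  have N0: "N \<ge> 0" using C R by (simp add: N_def)
  define F where "F z = of_real (ph z) * g z" for z
  define E where "E z h = of_real (ph z) * D z h + of_real (Re h * phx z + Im h * phy z) * g z" for z h
  have dF: "(F has_derivative E z) (at z)" for z
    unfolding F_def E_def
    by (rule derivative_eq_intros has_derivative_of_real dph der)+ simp
  have "norm (E z h) \<le> (M * C + 2 * M * N) * norm h" for z h
  proof (cases "norm z \<le> R")
    case True
    have "\<bar>Re h * phx z + Im h * phy z\<bar> \<le> norm h * M + norm h * M"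
      unfolding abs_mult
      by (intro order_trans[OF abs_triangle_ineq] add_mono)
         (auto simp: abs_mult intro!: mult_mono b abs_Re_le_cmod abs_Im_le_cmod)
    moreover have "norm (E z h) \<le> \<bar>ph z\<bar> * norm (D z h) + \<bar>Re h * phx z + Im h * phy z\<bar> * norm (g z)"
      unfolding E_def by (intro order_trans[OF norm_triangle_ineq]) (simp only: norm_mult norm_of_real order_refl)
    ultimately have "norm (E z h) \<le> M * (C * norm h) + (norm h * M + norm h * M) * N"
      using M N[OF True] b(1)[of z] bd[of z h] C
      by (elim order_trans) (intro add_mono mult_mono; simp)
    then show ?thesis by (simp add: algebra_simps)
  next
    case False
    then show ?thesis using out[of z] M C N0 by (simp add: E_def)
  qed
  note lip = lipschitz_of_derivative_bound[OF dF this]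
  have F0: "F z = 0" if "norm z > R" for z
    using out[OF that] by (simp add: F_def)
  note E = integral_derivative_eq_0[OF lip F0 dF, where e = e]
  define p where "p z = of_real (Re e * phx z + Im e * phy z) * g z" for z
  have "p = (\<lambda>z. indicator (cball 0 R) z *\<^sub>R p z)"
    using out by (auto simp: indicator_def fun_eq_iff p_def)
  moreover have "continuous_on (cball 0 R) p"
    unfolding p_def using c by (intro continuous_intros) (auto intro: continuous_on_subset)
  ultimately have ip: "integrable lborel p"
    using borel_integrable_compact[of "cball 0 R" p] by simp
  have "(LINT z|lborel. of_real (ph z) * D z e) = (LINT z|lborel. E z e - p z)"
    by (simp add: E_def p_def)
  also have "\<dots> = - (LINT z|lborel. p z)"
    using E ip by simp
  finally show ?thesis by (simp add: p_def)
qed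

section \<open>Quasiregularity of pointwise limits\<close>

text \<open>The uniform Lipschitz constant \<open>2 * C\<close> lets integration by parts pass to
  the limit by dominated convergence, so the pointwise limits of the derivatives are weak partials
  of \<open>g\<close>. The normalisation at \<open>0\<close> bounds all \<open>G n\<close> on a ball
  at once, and \<open>ab\<close> bounds the dilatation.\<close>

lemma quasiregular_limit:
  fixes G :: "nat \<Rightarrow> complex \<Rightarrow> complex"
  assumes der: "\<And>n z. (G n has_derivative (\<lambda>v. a n z * v + b n z * cnj v)) (at z)"
    and bd: "\<And>n z. norm (a n z) \<le> C"
    and G0: "\<And>n. G n 0 = 0"
    and limG: "\<And>z. (\<lambda>n. G n z) \<longlonglongrightarrow> g z"
    and lima: "\<And>z. (\<lambda>n. a n z) \<longlonglongrightarrow> a' z"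
    and limb: "\<And>z. (\<lambda>n. b n z) \<longlonglongrightarrow> b' z"
    and ab: "\<And>n z. norm (b n z) \<le> norm (a n z) / 2"
  shows "quasiregular g"
proof -
  define D where "D n z v = a n z * v + b n z * cnj v" for n z v
  have derD: "(G n has_derivative D n z) (at z)" for n z
    unfolding D_def by (rule der)
  have bD: "norm (D n z v) \<le> (2 * C) * norm v" for n z v
  proof -
    have "norm (D n z v) \<le> norm (a n z) * norm v + norm (b n z) * norm v"
      unfolding D_def by (metis norm_triangle_ineq norm_mult complex_mod_cnj)
    also have "\<dots> \<le> C * norm v + C * norm v"
      using bd[of n z] ab[of n z] norm_ge_zero[of "a n z"]
      by (intro add_mono mult_right_mono; (linarith | simp))
    finally show ?thesis by simp
  qed
  \<comment> \<open>\<open>u\<close> and \<open>v\<close> are the partials in the directions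
    \<open>1\<close> and \<open>\<i>\<close>, recovered from the derivatives with respect to
    \<open>z\<close> and its conjugate.\<close>
  define u where "u z = a' z + b' z" for z
  define v where "v z = \<i> * (a' z - b' z)" for z
  have limu: "(\<lambda>n. D n z 1) \<longlonglongrightarrow> u z" for z
    unfolding D_def u_def using lima limb by (auto intro!: tendsto_intros)
  have limv: "(\<lambda>n. D n z \<i>) \<longlonglongrightarrow> v z" for z
  proof -
    have "(\<lambda>n. \<i> * (a n z - b n z)) \<longlonglongrightarrow> v z"
      unfolding v_def by (intro tendsto_intros lima limb)
    then show ?thesis by (simp add: D_def algebra_simps)
  qed
  have lipG: "norm (G n x - G n y) \<le> (2 * C) * norm (x - y)" for n x y
    by (rule lipschitz_of_derivative_bound[OF derD bD])
  have "norm (g x - g y) \<le> (2 * C) * norm (x - y)" for x y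
    by (rule tendsto_upperbound[OF tendsto_norm[OF tendsto_diff[OF limG limG]]]) (auto simp: lipG)
  moreover have C: "C \<ge> 0" using bd[of 0 0] norm_ge_zero order_trans by blast
  ultimately have contg: "continuous_on UNIV g"
    by (intro lipschitz_on_continuous_on[of "2 * C"] lipschitz_onI) (auto simp: dist_norm)
  have contG: "continuous_on UNIV (G n)" for n
    using derD by (auto intro!: continuous_at_imp_continuous_on has_derivative_continuous)
  have [measurable]: "G n \<in> borel_measurable borel" "g \<in> borel_measurable borel" for n
    using contG contg by (auto intro: borel_measurable_continuous_onI)
  have [measurable]: "(\<lambda>z. D n z e) \<in> borel_measurable borel" for n e
    by (rule borel_measurable_LIMSEQ_metric[OF _ difference_quotient_tendsto[OF derD]]) measurable
  have mu[measurable]: "u \<in> borel_measurable borel"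
    by (rule borel_measurable_LIMSEQ_metric[OF _ limu]) measurable
  have mv[measurable]: "v \<in> borel_measurable borel"
    by (rule borel_measurable_LIMSEQ_metric[OF _ limv]) measurable
  have bu: "norm (u z) \<le> 2 * C" for z
    by (rule tendsto_upperbound[OF tendsto_norm[OF limu]]) (use bD[of _ z 1] in auto)
  have bv: "norm (v z) \<le> 2 * C" for z
    by (rule tendsto_upperbound[OF tendsto_norm[OF limv]]) (use bD[of _ z \<i>] in auto)
  have L2: "L2_loc w" if [measurable]: "w \<in> borel_measurable borel" and w: "\<And>z. norm (w z) \<le> 2 * C" for w
    unfolding L2_loc_def set_integrable_def
  proof (intro conjI allI impI)
    fix K :: "complex set" assume K: "compact K"
    then have [measurable]: "K \<in> sets borel" by (simp add: borel_compact)
    show "integrable lborel (\<lambda>z. indicator K z *\<^sub>R (cmod (w z))\<^sup>2)"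
    proof (rule integrableI_bounded_set[where A = K and B = "(2 * C)\<^sup>2"])
      show "emeasure lborel K < \<infinity>"
        using emeasure_compact_finite[OF K] by simp
      show "AE z in lborel. z \<in> K \<longrightarrow> norm (indicator K z *\<^sub>R (cmod (w z))\<^sup>2) \<le> (2 * C)\<^sup>2"
        using power_mono[OF w, of _ 2] by (auto intro!: AE_I2)
    qed auto
  qed (use that in simp)
  have wp: "(LINT z|lborel. of_real (Re e * phx z + Im e * phy z) * g z) = - (LINT z|lborel. of_real (ph z) * w z)"
    if tf: "test_fun ph phx phy" and limw: "\<And>z. (\<lambda>n. D n z e) \<longlonglongrightarrow> w z"
      and [measurable]: "w \<in> borel_measurable borel" for e ph phx phy w
  proof -
    obtain R M where R: "R > 0" and M: "M \<ge> 0"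
      and out: "\<And>z. norm z > R \<Longrightarrow> ph z = 0 \<and> phx z = 0 \<and> phy z = 0"
      and b: "\<And>z. \<bar>ph z\<bar> \<le> M" "\<And>z. \<bar>phx z\<bar> \<le> M" "\<And>z. \<bar>phy z\<bar> \<le> M"
      using test_fun_bounds[OF tf] by metis
    have dph: "(ph has_derivative (\<lambda>h. Re h * phx z + Im h * phy z)) (at z)" for z
      using tf by (auto simp: test_fun_def)
    have "continuous_on UNIV ph" "continuous_on UNIV phx" "continuous_on UNIV phy"
      using tf dph by (auto simp: test_fun_def intro!: continuous_at_imp_continuous_on has_derivative_continuous)
    then have [measurable]: "ph \<in> borel_measurable borel" "phx \<in> borel_measurable borel" "phy \<in> borel_measurable borel"
      by (auto intro: borel_measurable_continuous_onI)
    have int: "integrable lborel (\<lambda>z. indicator (cball 0 R) z * c)" for c :: real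
      by (intro integrable_mult_left integrable_real_indicator) (simp_all add: emeasure_bounded_finite[unfolded infinity_ennreal_def])
    define c1 where "c1 = (norm e * M + norm e * M) * (2 * C * R)"
    have "norm (of_real (Re e * phx z + Im e * phy z) * G n z) \<le> indicator (cball 0 R) z * c1" for n z
    proof (cases "norm z \<le> R")
      case True
      have "\<bar>Re e * phx z + Im e * phy z\<bar> \<le> norm e * M + norm e * M"
        by (intro order_trans[OF abs_triangle_ineq] add_mono)
           (auto simp: abs_mult intro!: mult_mono b abs_Re_le_cmod abs_Im_le_cmod)
      moreover have "norm (G n z) \<le> 2 * C * R"
        using lipG[of n z 0] mult_left_mono[OF True, of "2 * C"] C by (simp add: G0)
      ultimately have "\<bar>Re e * phx z + Im e * phy z\<bar> * norm (G n z) \<le> c1"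
        unfolding c1_def by (rule mult_mono) (use M in auto)
      then show ?thesis
        using True unfolding norm_mult norm_of_real by simp
    qed (use out in simp)
    then have A: "(\<lambda>n. LINT z|lborel. of_real (Re e * phx z + Im e * phy z) * G n z)
        \<longlonglongrightarrow> (LINT z|lborel. of_real (Re e * phx z + Im e * phy z) * g z)"
      by (intro integral_dominated_convergence[OF _ _ int]) (auto intro!: tendsto_intros limG)
    have "norm (of_real (ph z) * D n z e) \<le> indicator (cball 0 R) z * (M * (2 * C * norm e))" for n z
    proof (cases "norm z \<le> R")
      case True
      then show ?thesis using b(1)[of z] bD[of n z e] M C by (auto simp: norm_mult intro!: mult_mono)
    qed (use out in simp)
    then have B: "(\<lambda>n. LINT z|lborel. of_real (ph z) * D n z e) \<longlonglongrightarrow> (LINT z|lborel. of_real (ph z) * w z)"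
      by (intro integral_dominated_convergence[OF _ _ int]) (auto intro!: tendsto_intros limw)
    show ?thesis
      using A tendsto_minus[OF B] unfolding integration_by_parts_test_fun[OF tf derD bD]
      by (rule LIMSEQ_unique)
  qed
  have "weak_partials g u v"
    unfolding weak_partials_def using wp[OF _ limu mu] wp[OF _ limv mv] by auto
  moreover have "(u z - \<i> * v z) / 2 = a' z" "(u z + \<i> * v z) / 2 = b' z" for z
    by (simp_all add: u_def v_def algebra_simps flip: mult.assoc)
  \<comment> \<open>The constant is \<open>3 = (1 + 1/2) / (1 - 1/2)\<close>, the dilatation when
    \<open>b'\<close> has half the modulus of \<open>a'\<close>.\<close>
  moreover have "(norm (a' z) + norm (b' z))\<^sup>2 \<le> 3 * ((norm (a' z))\<^sup>2 - (norm (b' z))\<^sup>2)" for z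
  proof -
    have "norm (b' z) \<le> norm (a' z) / 2"
      by (rule tendsto_le[OF _ tendsto_divide[OF tendsto_norm[OF lima] tendsto_const] tendsto_norm[OF limb]])
         (use ab in \<open>auto simp: field_simps\<close>)
    then have "(norm (a' z) + norm (b' z)) * (norm (a' z) + norm (b' z))
        \<le> (norm (a' z) + norm (b' z)) * (3 * (norm (a' z) - norm (b' z)))"
      by (intro mult_left_mono) auto
    then show ?thesis by (simp add: power2_eq_square algebra_simps)
  qed
  ultimately show ?thesis
    unfolding quasiregular_def using contg L2[OF mu bu] L2[OF mv bv]
    by (intro conjI exI[of _ u] exI[of _ v] exI[of _ "3::real"]) auto
qed

section \<open>The exponential map and its inverse branch\<close>

definition shifted_exp :: "complex \<Rightarrow> complex" where
  "shifted_exp z = exp (z - 5)"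

text \<open>This is the image of the open disc of radius \<open>5/2\<close> under
  \<open>shifted_exp\<close>, encoded through the inverse branch \<open>Ln z + 5\<close> that the
  recursion uses.\<close>

definition trap :: "complex set" where
  "trap = {z. z \<notin> \<real>\<^sub>\<le>\<^sub>0 \<and> norm (Ln z + 5) < 5/2}"

text \<open>The shift by \<open>5\<close> serves this estimate: the disc of radius \<open>3\<close>
  lands inside the disc of radius \<open>1/4\<close>, which leaves room for the seed in
  between.\<close>

lemma norm_shifted_exp_less:
  assumes "norm z < 3"
  shows "norm (shifted_exp z) < 1/4"
proof -
  have "Re z < 3" using assms abs_Re_le_cmod[of z] by linarith
  then have "norm (shifted_exp z) < exp (-2)"
    by (simp add: shifted_exp_def)
  also have "exp (-2 :: real) \<le> 1/4"
  proof -
    have "4 \<le> exp (2::real)"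
      using power_mono[OF exp_ge_add_one_self[of "1::real"], of 2] by (simp flip: exp_of_nat_mult)
    then show ?thesis by (simp add: exp_minus field_simps)
  qed
  finally show ?thesis .
qed

lemma shifted_exp_nonzero [simp]: "shifted_exp z \<noteq> 0"
  by (simp add: shifted_exp_def)

text \<open>Since \<open>3 < pi\<close>, the imaginary part stays within the principal branch. The
  margin between \<open>5/2\<close> and \<open>3\<close> is used later to glue across the circle of
  radius \<open>5/2\<close>.\<close>

lemma Ln_shifted_exp:
  assumes "norm z < 3"
  shows "Ln (shifted_exp z) + 5 = z"
proof -
  have "\<bar>Im (z - 5)\<bar> < pi" using assms abs_Im_le_cmod[of z] pi_gt3 by simp
  then show ?thesis by (simp add: shifted_exp_def)
qed

lemma shifted_exp_in_trap_iff:
  assumes "norm z < 3"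
  shows "shifted_exp z \<in> trap \<longleftrightarrow> norm z < 5/2"
proof -
  have "shifted_exp z \<notin> \<real>\<^sub>\<le>\<^sub>0"
  proof
    assume "shifted_exp z \<in> \<real>\<^sub>\<le>\<^sub>0"
    then have "Re (shifted_exp z) < 0 \<and> Im (shifted_exp z) = 0"
      using shifted_exp_nonzero[of z] by (auto simp: complex_nonpos_Reals_iff complex_eq_iff less_le)
    then have "Im (Ln (shifted_exp z)) = pi"
      by (simp add: Im_Ln_eq_pi)
    moreover have "Ln (shifted_exp z) = z - 5" using Ln_shifted_exp[OF assms] by (simp add: eq_diff_eq)
    ultimately show False using assms abs_Im_le_cmod[of z] pi_gt3 by simp
  qed
  then show ?thesis by (simp add: trap_def Ln_shifted_exp[OF assms])
qed

lemma shifted_exp_Ln: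
  assumes "z \<in> trap"
  shows "shifted_exp (Ln z + 5) = z"
  using assms by (cases "z = 0") (auto simp: trap_def shifted_exp_def)

lemma norm_trap_less:
  assumes "z \<in> trap"
  shows "norm z < 1/4"
  using norm_shifted_exp_less[of "Ln z + 5"] shifted_exp_Ln[OF assms] assms by (simp add: trap_def)

lemma zero_notin_trap: "0 \<notin> trap"
  by (simp add: trap_def)

lemma open_trap: "open trap"
proof -
  have "open ((\<lambda>z. Ln z + 5) -` ball 0 (5/2) \<inter> - \<real>\<^sub>\<le>\<^sub>0)"
    by (rule continuous_on_open_vimage[THEN iffD1, rule_format])
       (auto intro!: continuous_intros simp: open_Compl)
  moreover have "trap = ((\<lambda>z. Ln z + 5) -` ball 0 (5/2) \<inter> - \<real>\<^sub>\<le>\<^sub>0)"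
    by (auto simp: trap_def)
  ultimately show ?thesis by simp
qed

lemma has_derivative_shifted_exp:
  "(shifted_exp has_derivative (\<lambda>v. shifted_exp z * v)) (at z within S)"
  unfolding shifted_exp_def by (auto intro!: derivative_eq_intros)

text \<open>The factor \<open>7/6\<close> is chosen so that \<open>7/6 * 3/4 = 7/8\<close>, the
  contraction rate in \<open>k_trap\<close>.\<close>

lemma norm_exp_minus_one_le:
  fixes x :: complex
  assumes "norm x \<le> 1/64"
  shows "norm (exp x - 1) \<le> 7/6 * norm x"
proof -
  have "norm (exp x - 1) \<le> exp (norm x) * norm x"
    using Taylor_exp_field[of x 0] by simp
  also have "\<dots> \<le> 7/6 * norm x"
    using real_exp_bound_lemma[of "norm x"] assms by (intro mult_right_mono) auto
  finally show ?thesis .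
qed

section \<open>The seed and its transport along orbits\<close>

text \<open>\<open>s\<close> is the seed. The constants fit together in \<open>A_bound\<close>:
  \<open>3/2 = 2 - 32 * (1/64)\<close>.\<close>

locale perturbation =
  fixes s sa sb :: "complex \<Rightarrow> complex"
  assumes s_deriv: "(s has_derivative (\<lambda>v. sa z * v + sb z * cnj v)) (at z)"
    and s_id: "norm (z - 1/2) > 1/4 \<Longrightarrow> s z = z"
    and s_near: "norm (s z - z) \<le> norm z / 64"
    and sa_bound: "norm (sa z) \<le> 3/2"
    and sb_bound: "norm (sb z) \<le> norm (sa z) / 2"
begin

text \<open>Each stage applies the functional equation once, forwards on \<open>trap\<close> and
  backwards outside the disc. The logarithm is taken of a quotient close to \<open>1\<close>, so the
  principal branch is the right one.\<close>

primrec G :: "nat \<Rightarrow> complex \<Rightarrow> complex" where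
  "G 0 = (\<lambda>z. z)"
| "G (Suc n) = (\<lambda>z. if z \<in> trap then shifted_exp (G n (Ln z + 5))
     else if norm z < 5/2 then s z
     else z + Ln (G n (shifted_exp z) / shifted_exp z))"

text \<open>\<open>A\<close> and \<open>B\<close> follow the chain rule for \<open>G\<close>.
  Conjugates enter \<open>B\<close> because the inner conformal factor acts on \<open>v\<close>
  before conjugation. In the outer case the \<open>v\<close> from the summand \<open>z\<close>
  cancels against the derivative of the denominator.\<close>

primrec A :: "nat \<Rightarrow> complex \<Rightarrow> complex" where
  "A 0 = (\<lambda>z. 1)"
| "A (Suc n) = (\<lambda>z. if z \<in> trap then G (Suc n) z / z * A n (Ln z + 5)
     else if norm z < 5/2 then sa z
     else A n (shifted_exp z) * (shifted_exp z / G n (shifted_exp z)))"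

primrec B :: "nat \<Rightarrow> complex \<Rightarrow> complex" where
  "B 0 = (\<lambda>z. 0)"
| "B (Suc n) = (\<lambda>z. if z \<in> trap then G (Suc n) z / cnj z * B n (Ln z + 5)
     else if norm z < 5/2 then sb z
     else B n (shifted_exp z) * (cnj (shifted_exp z) / G n (shifted_exp z)))"

lemma step_trap:
  assumes "z \<in> trap"
  shows "G (Suc n) z = shifted_exp (G n (Ln z + 5))"
    "A (Suc n) z = G (Suc n) z / z * A n (Ln z + 5)"
    "B (Suc n) z = G (Suc n) z / cnj z * B n (Ln z + 5)"
  using assms by simp_all

lemma step_seed:
  assumes "z \<notin> trap" "norm z < 5/2"
  shows "G (Suc n) z = s z" "A (Suc n) z = sa z" "B (Suc n) z = sb z"
  using assms by simp_all

lemma step_outer: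
  assumes "z \<notin> trap" "\<not> norm z < 5/2"
  shows "G (Suc n) z = z + Ln (G n (shifted_exp z) / shifted_exp z)"
    "A (Suc n) z = A n (shifted_exp z) * (shifted_exp z / G n (shifted_exp z))"
    "B (Suc n) z = B n (shifted_exp z) * (cnj (shifted_exp z) / G n (shifted_exp z))"
  using assms by simp_all

declare G.simps(2) [simp del] A.simps(2) [simp del] B.simps(2) [simp del]

lemma s_id': "norm z < 1/4 \<or> norm z > 3/4 \<Longrightarrow> s z = z"
proof (rule s_id)
  assume "norm z < 1/4 \<or> norm z > 3/4"
  then show "norm (z - 1/2) > 1/4"
    using norm_triangle_ineq3[of z "1/2"] by auto
qed

lemma G_zero: "G n 0 = 0"
  by (cases n) (auto simp: step_seed zero_notin_trap s_id')

lemma G_outside_trap: "norm z < 1/4 \<Longrightarrow> z \<notin> trap \<Longrightarrow> G n z = z"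
  by (cases n) (auto simp: step_seed s_id')

text \<open>The identity holds on both sides of the circle of radius \<open>5/2\<close>, where the
  definition of \<open>G\<close> switches branches; this is what makes the branches glue
  smoothly.\<close>

lemma G_annulus:
  assumes "3/4 < norm z" "norm z < 3"
  shows "G n z = z"
proof (cases n)
  case (Suc m)
  have "z \<notin> trap" using norm_trap_less[of z] assms by auto
  moreover have "G m (shifted_exp z) = shifted_exp z" if "norm z \<ge> 5/2"
    using that assms norm_shifted_exp_less[of z] by (intro G_outside_trap) (auto simp: shifted_exp_in_trap_iff)
  ultimately show ?thesis
    using assms by (cases "norm z < 5/2") (auto simp: Suc step_seed step_outer s_id')
qed simp

lemma G_shifted_exp_annulus:
  assumes "3/4 < norm z" "norm z < 3"
  shows "G n (shifted_exp z) = shifted_exp z"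
proof (cases "norm z < 5/2")
  case True
  then show ?thesis
    using assms by (cases n) (auto simp: step_trap shifted_exp_in_trap_iff Ln_shifted_exp G_annulus)
next
  case False
  then show ?thesis
    using assms norm_shifted_exp_less[of z] by (intro G_outside_trap) (auto simp: shifted_exp_in_trap_iff)
qed

section \<open>Contraction of the relative displacement and bounded distortion\<close>

text \<open>Division by zero gives \<open>k n 0 = 0\<close>, so the bounds below hold at the origin
  too.\<close>

definition k :: "nat \<Rightarrow> complex \<Rightarrow> complex" where
  "k n z = (G n z - z) / z"

lemma G_eq: "G n z = z * (1 + k n z)"
  by (cases "z = 0") (simp_all add: k_def G_zero field_simps)

lemma k_seed:
  assumes "z \<notin> trap" "norm z < 5/2"
  shows "norm (k (Suc n) z) \<le> 1/64"
  using s_near[of z] assms by (cases "z = 0") (auto simp: k_def step_seed norm_divide divide_simps)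

text \<open>With \<open>y = Ln z + 5\<close>, conjugation gives
  \<open>k (Suc n) z = exp (y * k n y) - 1\<close>. Either \<open>norm y\<close> is at most
  \<open>3/4\<close> or \<open>k n y\<close> vanishes by \<open>G_annulus\<close>, so the
  contraction factor is \<open>7/6 * 3/4\<close>.\<close>

lemma k_trap:
  assumes z: "z \<in> trap" and k: "norm (k n (Ln z + 5)) \<le> 1/64"
  shows "norm (k (Suc n) z) \<le> 7/8 * norm (k n (Ln z + 5))"
proof -
  define y where "y = Ln z + 5"
  have y: "norm y < 5/2" and fy: "shifted_exp y = z"
    using z shifted_exp_Ln[OF z] by (auto simp: y_def trap_def)
  have z0: "z \<noteq> 0" using z zero_notin_trap by auto
  have "G (Suc n) z = shifted_exp (y + y * k n y)"
    using z by (simp add: step_trap G_eq[of n] algebra_simps flip: y_def)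
  also have "\<dots> = z * exp (y * k n y)"
    by (simp add: fy[symmetric] shifted_exp_def flip: exp_add) (simp add: algebra_simps)
  finally have eq: "k (Suc n) z = exp (y * k n y) - 1"
    using z0 by (simp only: k_def) (simp add: field_simps)
  have le: "norm (y * k n y) \<le> 3/4 * norm (k n y)"
  proof (cases "norm y \<le> 3/4")
    case True
    then show ?thesis using mult_right_mono[OF True norm_ge_zero[of "k n y"]] by (simp add: norm_mult)
  next
    case False
    then have "k n y = 0" using y by (simp add: k_def G_annulus)
    then show ?thesis by simp
  qed
  have "norm (k (Suc n) z) \<le> 7/6 * norm (y * k n y)"
    unfolding eq by (rule norm_exp_minus_one_le) (use le k in \<open>simp add: y_def\<close>)
  with le show ?thesis by (simp add: y_def)
qed

text \<open>The logarithm costs at most a factor \<open>2\<close> and division by \<open>z\<close>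
  gains \<open>5/2\<close>; the resulting \<open>4/5\<close> is below \<open>7/8\<close>.\<close>

lemma k_outer:
  assumes z: "norm z \<ge> 5/2" and k: "norm (k n (shifted_exp z)) \<le> 1/64"
  shows "norm (k (Suc n) z) \<le> 7/8 * norm (k n (shifted_exp z))"
proof -
  have "z \<notin> trap" using norm_trap_less[of z] z by auto
  then have "k (Suc n) z = Ln (1 + k n (shifted_exp z)) / z"
    using z by (simp add: k_def[of "Suc n"] step_outer G_eq[of n])
  moreover have "norm (Ln (1 + k n (shifted_exp z))) \<le> 2 * norm (k n (shifted_exp z))"
    by (rule norm_Ln_le) (use k in simp)
  moreover have "2 * norm (k n (shifted_exp z)) \<le> (7/8 * norm (k n (shifted_exp z))) * norm z"
  proof -
    have "2 * norm (k n (shifted_exp z)) \<le> 7/8 * norm (k n (shifted_exp z)) * (5/2)" by simp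
    also have "\<dots> \<le> 7/8 * norm (k n (shifted_exp z)) * norm z"
      by (rule mult_left_mono[OF z]) simp
    finally show ?thesis .
  qed
  ultimately show ?thesis
    using z by (auto simp: norm_divide divide_le_eq)
qed

lemma k_bound: "norm (k n z) \<le> 1/64"
proof (induction n arbitrary: z)
  case 0
  then show ?case by (simp add: k_def)
next
  case (Suc n)
  show ?case
    using k_trap[of z n, OF _ Suc] k_outer[of z n, OF _ Suc] k_seed[of z n] Suc[of "Ln z + 5"] Suc[of "shifted_exp z"]
    by fastforce
qed

lemma one_plus_k_bounds: "1 - norm (k n z) \<le> norm (1 + k n z)" "norm (1 + k n z) \<le> 1 + norm (k n z)"
  using norm_triangle_ineq2[of 1 "- k n z"] norm_triangle_ineq[of 1 "k n z"] by auto

lemma G_nonzero: "z \<noteq> 0 \<Longrightarrow> G n z \<noteq> 0"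
  using one_plus_k_bounds(1)[of n z] k_bound[of n z] by (auto simp: G_eq)

text \<open>The weight on the right absorbs the distortion factor of every step, because \<open>k\<close>
  decays geometrically along a pull-back.\<close>

lemma A_bound: "norm (A n z) \<le> 2 - 32 * norm (k n z)"
proof (induction n arbitrary: z)
  case 0
  then show ?case by (simp add: k_def)
next
  case (Suc n)
  \<comment> \<open>The constants work because \<open>34 * 7/8 \<le> 32\<close> here and
    \<open>32 * 7/8 \<le> 30\<close> in \<open>step'\<close>; the product \<open>q * x\<close> has
    the favourable sign in both.\<close>
  have step: "(1 + q) * (2 - 32 * x) \<le> 2 - 32 * q"
    if "0 \<le> x" "x \<le> 1/64" "0 \<le> q" "q \<le> 7/8 * x" for x q :: real
  proof -
    have "0 \<le> q * x" using that by simp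
    moreover have "(1 + q) * (2 - 32 * x) = 2 + 2 * q - 32 * x - 32 * (q * x)"
      by (simp add: algebra_simps)
    ultimately show ?thesis using that by linarith
  qed
  have step': "2 - 32 * x \<le> (1 - x) * (2 - 32 * q)"
    if "0 \<le> x" "x \<le> 1/64" "0 \<le> q" "q \<le> 7/8 * x" for x q :: real
  proof -
    have "0 \<le> q * x" using that by simp
    moreover have "(1 - x) * (2 - 32 * q) = 2 - 32 * q - 2 * x + 32 * (q * x)"
      by (simp add: algebra_simps)
    ultimately show ?thesis using that by linarith
  qed
  show ?case
  proof (cases "z \<in> trap")
    case True
    define x where "x = norm (k n (Ln z + 5))"
    have z0: "z \<noteq> 0" using True zero_notin_trap by auto
    have "A (Suc n) z = (1 + k (Suc n) z) * A n (Ln z + 5)"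
      using True z0 by (simp add: step_trap(2) G_eq)
    then have "norm (A (Suc n) z) = norm (1 + k (Suc n) z) * norm (A n (Ln z + 5))"
      by (simp add: norm_mult)
    also have "\<dots> \<le> (1 + norm (k (Suc n) z)) * (2 - 32 * x)"
      by (rule mult_mono[OF one_plus_k_bounds(2) Suc[of "Ln z + 5", folded x_def]]) auto
    also have "\<dots> \<le> 2 - 32 * norm (k (Suc n) z)"
      by (rule step) (use k_bound k_trap[OF True k_bound] in \<open>auto simp: x_def\<close>)
    finally show ?thesis .
  next
    case nt: False
    show ?thesis
    proof (cases "norm z < 5/2")
      case True
      then show ?thesis
        using nt sa_bound[of z] k_seed[OF nt True, of n] by (simp add: step_seed)
    next
      case False
      define x where "x = norm (k n (shifted_exp z))"
      have x: "x \<le> 1/64" using k_bound by (simp add: x_def)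
      have "A (Suc n) z = A n (shifted_exp z) / (1 + k n (shifted_exp z))"
        using nt False by (simp add: step_outer G_eq)
      then have "norm (A (Suc n) z) * norm (1 + k n (shifted_exp z)) = norm (A n (shifted_exp z))"
        using one_plus_k_bounds(1)[of n "shifted_exp z"] x by (auto simp: norm_divide x_def)
      then have "norm (A (Suc n) z) * (1 - x) \<le> norm (A n (shifted_exp z))"
        using mult_left_mono[OF one_plus_k_bounds(1)[of n "shifted_exp z"], of "norm (A (Suc n) z)"] by (simp add: x_def)
      also have "\<dots> \<le> 2 - 32 * x" unfolding x_def by (rule Suc)
      also have "\<dots> \<le> (1 - x) * (2 - 32 * norm (k (Suc n) z))"
        by (rule step') (use x k_outer[OF _ k_bound, of z n] False in \<open>auto simp: x_def\<close>)
      finally show ?thesis using x by (simp add: mult.commute)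
    qed
  qed
qed

text \<open>A transport step multiplies \<open>A\<close> and \<open>B\<close> by factors of equal
  modulus, so their ratio keeps the bound imposed on the seed.\<close>

lemma B_bound: "norm (B n z) \<le> norm (A n z) / 2"
proof (induction n arbitrary: z)
  case (Suc n)
  consider "z \<in> trap" | "z \<notin> trap" "norm z < 5/2" | "z \<notin> trap" "\<not> norm z < 5/2" by blast
  then show ?case
  proof cases
    case 1
    then show ?thesis
      using mult_left_mono[OF Suc, of "norm (G (Suc n) z / z)" "Ln z + 5"]
      by (simp add: step_trap norm_mult norm_divide)
  next
    case 2
    then show ?thesis using sb_bound[of z] by (simp add: step_seed)
  next
    case 3
    then show ?thesis
      using mult_right_mono[OF Suc, of "norm (shifted_exp z / G n (shifted_exp z))" "shifted_exp z"]
      by (simp add: step_outer norm_mult norm_divide)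
  qed
qed simp

section \<open>Differentiability and stabilisation of the approximations\<close>

text \<open>Each branch formula remains valid on an open neighbourhood of its region, because near
  the common boundaries all of them give the identity.\<close>

lemma G_has_derivative: "(G n has_derivative (\<lambda>v. A n z * v + B n z * cnj v)) (at z)"
proof (induction n arbitrary: z)
  case 0
  then show ?case by simp
next
  case (Suc n)
  consider "z \<in> trap" | "z \<notin> trap" "norm z < 5/2" | "norm z \<ge> 5/2" by linarith
  then show ?case
  proof cases
    case 1
    then have z: "z \<notin> \<real>\<^sub>\<le>\<^sub>0" "z \<noteq> 0" using zero_notin_trap by (auto simp: trap_def)
    define y where "y = Ln z + 5"
    have "((\<lambda>z. Ln z + 5) has_derivative (\<lambda>v. v / z)) (at z)"
      using z by (auto intro!: derivative_eq_intros simp: has_field_derivative_def divide_inverse mult.commute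
          intro: has_field_derivative_Ln[unfolded has_field_derivative_def, THEN has_derivative_eq_rhs])
    from has_derivative_compose[OF has_derivative_compose[OF this Suc] has_derivative_shifted_exp]
    have "((\<lambda>z. shifted_exp (G n (Ln z + 5))) has_derivative
        (\<lambda>v. shifted_exp (G n y) * (A n y * (v / z) + B n y * cnj (v / z)))) (at z)"
      by (simp add: y_def)
    then have "(G (Suc n) has_derivative
        (\<lambda>v. shifted_exp (G n y) * (A n y * (v / z) + B n y * cnj (v / z)))) (at z)"
      by (rule has_derivative_transform_within_open[OF _ open_trap 1]) (simp add: step_trap)
    moreover have "(\<lambda>v. shifted_exp (G n y) * (A n y * (v / z) + B n y * cnj (v / z)))
        = (\<lambda>v. A (Suc n) z * v + B (Suc n) z * cnj v)"
      using 1 by (auto simp: step_trap y_def fun_eq_iff field_simps)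
    ultimately show ?thesis by simp
  next
    case 2
    \<comment> \<open>\<open>U\<close> reaches into \<open>trap\<close> only at images of points of
      modulus above \<open>1\<close>, where the transported map is still the identity, as is the
      seed. This covers the boundary of \<open>trap\<close>.\<close>
    define U where "U = ball 0 3 - shifted_exp ` cball 0 1"
    have "compact (shifted_exp ` cball 0 1)"
      by (intro compact_continuous_image compact_cball) (auto simp: shifted_exp_def intro!: continuous_intros)
    then have "open U" unfolding U_def by (intro open_Diff open_ball compact_imp_closed)
    moreover have "z \<in> U"
      using 2 shifted_exp_in_trap_iff by (fastforce simp: U_def)
    moreover have "s w = G (Suc n) w" if w: "w \<in> U" for w
    proof (cases "w \<in> trap")
      case True
      define y where "y = Ln w + 5"
      have fy: "shifted_exp y = w" "norm y < 3"
        using shifted_exp_Ln[OF True] True by (auto simp: y_def trap_def)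
      have "norm y > 1" using w fy by (force simp: U_def)
      then have "G n y = y" using fy by (intro G_annulus) auto
      then show ?thesis using True fy norm_trap_less[OF True] by (simp add: step_trap s_id' flip: y_def)
    next
      case False
      show ?thesis
      proof (cases "norm w < 5/2")
        case True
        then show ?thesis using False by (simp add: step_seed)
      next
        case nw: False
        have "G (Suc n) w = w" using w nw by (intro G_annulus) (auto simp: U_def)
        then show ?thesis using nw by (simp add: s_id')
      qed
    qed
    ultimately have "(G (Suc n) has_derivative (\<lambda>v. sa z * v + sb z * cnj v)) (at z)"
      by (rule has_derivative_transform_within_open[OF s_deriv])
    then show ?thesis using 2 by (simp add: step_seed)
  next
    case 3
    then have nt: "z \<notin> trap" using norm_trap_less[of z] by auto
    define w where "w = shifted_exp z"
    have w0: "w \<noteq> 0" "G n w \<noteq> 0" by (simp_all add: w_def G_nonzero)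
    have "G n w / w \<notin> \<real>\<^sub>\<le>\<^sub>0"
    proof -
      have "G n w / w = 1 + k n w" using w0 by (simp add: G_eq)
      moreover have "Re (k n w) > -1" using k_bound[of n w] abs_Re_le_cmod[of "k n w"] by linarith
      ultimately show ?thesis by (simp add: complex_nonpos_Reals_iff)
    qed
    then have Ln': "(Ln has_derivative (\<lambda>v. inverse (G n w / w) * v)) (at (G n (shifted_exp z) / shifted_exp z))"
      using has_field_derivative_Ln[of "G n w / w"] unfolding has_field_derivative_def w_def by blast
    have "((\<lambda>z. G n (shifted_exp z)) has_derivative (\<lambda>v. A n w * (w * v) + B n w * cnj (w * v))) (at z)"
      using has_derivative_compose[OF has_derivative_shifted_exp Suc] by (simp add: w_def)
    from has_derivative_divide'[OF this has_derivative_shifted_exp]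
    have q: "((\<lambda>z. G n (shifted_exp z) / shifted_exp z) has_derivative
      (\<lambda>v. ((A n w * (w * v) + B n w * cnj (w * v)) * w - G n w * (w * v)) / (w * w))) (at z)"
      by (simp add: w_def)
    have "((\<lambda>z. z + Ln (G n (shifted_exp z) / shifted_exp z)) has_derivative
      (\<lambda>v. v + inverse (G n w / w) * (((A n w * (w * v) + B n w * cnj (w * v)) * w - G n w * (w * v)) / (w * w)))) (at z)"
      by (intro has_derivative_add has_derivative_ident has_derivative_compose[OF q Ln'])
    then have "(G (Suc n) has_derivative
      (\<lambda>v. v + inverse (G n w / w) * (((A n w * (w * v) + B n w * cnj (w * v)) * w - G n w * (w * v)) / (w * w)))) (at z)"
    proof (rule has_derivative_transform_within_open)
      \<comment> \<open>For modulus between \<open>1\<close> and \<open>5/2\<close> the outer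
        formula reads \<open>x + Ln 1\<close>, which agrees with the seed; this covers the circle of
        radius \<open>5/2\<close>.\<close>
      show "open (- cball 0 1 :: complex set)" by (simp add: open_Compl)
      show "z \<in> - cball 0 1" using 3 by simp
      fix x :: complex assume "x \<in> - cball 0 1"
      then have x: "norm x > 1" by simp
      then have "x \<notin> trap" using norm_trap_less[of x] by auto
      then show "x + Ln (G n (shifted_exp x) / shifted_exp x) = G (Suc n) x"
        using x G_shifted_exp_annulus[of x n] by (cases "norm x < 5/2") (auto simp: step_seed step_outer s_id')
    qed
    moreover have "(\<lambda>v. v + inverse (G n w / w) * (((A n w * (w * v) + B n w * cnj (w * v)) * w - G n w * (w * v)) / (w * w)))
       = (\<lambda>v. A (Suc n) z * v + B (Suc n) z * cnj v)"
      using nt 3 w0 by (auto simp: step_outer fun_eq_iff field_simps simp flip: w_def)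
    ultimately show ?thesis by simp
  qed
qed

text \<open>Each pointwise sequence changes value at most once, at the time at which the orbit
  of the point reaches the fundamental domain carrying the seed.\<close>

lemma identity_until_change:
  assumes "(G (Suc n) z, A (Suc n) z, B (Suc n) z) \<noteq> (G n z, A n z, B n z)" and "m \<le> n"
  shows "(G m z, A m z, B m z) = (z, 1, 0)"
  using assms
proof (induction n arbitrary: m z)
  case 0
  then show ?case by simp
next
  case (Suc n)
  show ?case
  proof (cases m)
    case m: (Suc l)
    then have l: "l \<le> n" using Suc.prems by simp
    show ?thesis
    proof (cases "z \<in> trap")
      case True
      then have "z \<noteq> 0" using zero_notin_trap by auto
      \<comment> \<open>The values at \<open>z\<close> are determined by those at
        \<open>Ln z + 5\<close> one stage earlier, so a change at \<open>z\<close> comes from a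
        change there.\<close>
      moreover have "(G (Suc n) (Ln z + 5), A (Suc n) (Ln z + 5), B (Suc n) (Ln z + 5))
          \<noteq> (G n (Ln z + 5), A n (Ln z + 5), B n (Ln z + 5))"
        using Suc.prems(1) by (auto simp: step_trap[OF True])
      ultimately show ?thesis using Suc.IH[OF _ l] True by (simp add: m step_trap shifted_exp_Ln)
    next
      case nt: False
      show ?thesis
      proof (cases "norm z < 5/2")
        case True
        then show ?thesis using Suc.prems(1) nt by (simp add: step_seed)
      next
        case False
        define w where "w = shifted_exp z"
        have "(G (Suc n) w, A (Suc n) w, B (Suc n) w) \<noteq> (G n w, A n w, B n w)"
          using Suc.prems(1) by (auto simp: step_outer[OF nt False] w_def)
        from Suc.IH[OF this l] show ?thesis using nt False by (simp add: m step_outer w_def)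
      qed
    qed
  qed simp
qed

lemma eventually_constant:
  "\<exists>x. \<forall>\<^sub>F n in sequentially. (G n z, A n z, B n z) = x"
proof (cases "\<exists>n. (G (Suc n) z, A (Suc n) z, B (Suc n) z) \<noteq> (G n z, A n z, B n z)")
  case True
  then obtain n where n: "(G (Suc n) z, A (Suc n) z, B (Suc n) z) \<noteq> (G n z, A n z, B n z)" by blast
  have "(G m z, A m z, B m z) = (G (Suc n) z, A (Suc n) z, B (Suc n) z)" if "m \<ge> Suc n" for m
    using that
  proof (induction m rule: dec_induct)
    case (step m)
    have "(G (Suc m) z, A (Suc m) z, B (Suc m) z) = (G m z, A m z, B m z)"
    proof (rule ccontr)
      assume "\<not> ?thesis"
      \<comment> \<open>A second change at \<open>m\<close> would force the values at both
        \<open>n\<close> and \<open>Suc n\<close> to be \<open>(z, 1, 0)\<close>, contradicting the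
        change at \<open>n\<close>.\<close>
      from identity_until_change[OF this, of n] identity_until_change[OF this, of "Suc n"] step n
      show False by simp
    qed
    with step show ?case by simp
  qed simp
  then show ?thesis by (auto simp: eventually_sequentially)
next
  case False
  then have "(G n z, A n z, B n z) = (G 0 z, A 0 z, B 0 z)" for n
    by (induction n) (metis)+
  then show ?thesis by (intro exI[of _ "(G 0 z, A 0 z, B 0 z)"] always_eventually) blast
qed

lemma commuting_quasiregular_extension:
  "\<exists>g. quasiregular g \<and> shifted_exp \<circ> g = g \<circ> shifted_exp \<and> (\<forall>z. norm (z - 1/2) \<le> 1/4 \<longrightarrow> g z = s z)"
proof -
  obtain X where X: "\<And>z. \<forall>\<^sub>F n in sequentially. (G n z, A n z, B n z) = X z"
    using eventually_constant by metis
  define g where "g z = fst (X z)" for z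
  have ev: "\<forall>\<^sub>F n in sequentially. G n z = g z"
    "\<forall>\<^sub>F n in sequentially. A n z = fst (snd (X z))"
    "\<forall>\<^sub>F n in sequentially. B n z = snd (snd (X z))" for z
    unfolding g_def by (rule eventually_mono[OF X[of z]], metis fst_conv snd_conv)+
  have "quasiregular g"
  proof (rule quasiregular_limit[where G = G and a = A and b = B and C = 2])
    show "norm (A n z) \<le> 2" for n z
      using A_bound[of n z] norm_ge_zero[of "k n z"] by linarith
  qed (rule G_has_derivative G_zero B_bound tendsto_eventually ev)+
  moreover have "shifted_exp (g z) = g (shifted_exp z)" for z
  proof -
    \<comment> \<open>At one common stage all four values have reached their limits, so a single
      step of the recursion becomes the exact commutation relation.\<close>
    have "\<forall>\<^sub>F n in sequentially. G n z = g z \<and> G (Suc n) z = g z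
        \<and> G n (shifted_exp z) = g (shifted_exp z) \<and> G (Suc n) (shifted_exp z) = g (shifted_exp z)"
      using ev(1) ev(1)[THEN eventually_sequentially_Suc[THEN iffD2]] by (intro eventually_conj) auto
    then obtain n where n: "G n z = g z" "G (Suc n) z = g z"
      "G n (shifted_exp z) = g (shifted_exp z)" "G (Suc n) (shifted_exp z) = g (shifted_exp z)"
      by (auto simp: eventually_sequentially)
    show ?thesis
    proof (cases "norm z < 5/2")
      case True
      then have "G (Suc n) (shifted_exp z) = shifted_exp (G n z)"
        by (simp add: step_trap shifted_exp_in_trap_iff Ln_shifted_exp)
      then show ?thesis using n by simp
    next
      case False
      define w where "w = shifted_exp z"
      have w: "w \<noteq> 0" "G n w \<noteq> 0" by (simp_all add: w_def G_nonzero)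
      have "z \<notin> trap" using False norm_trap_less[of z] by auto
      then have "g z = z + Ln (G n w / w)"
        using n(2) False by (simp add: step_outer w_def)
      then have "shifted_exp (g z) = w * exp (Ln (G n w / w))"
        by (simp add: w_def shifted_exp_def add_diff_eq flip: exp_add) (simp add: algebra_simps)
      then show ?thesis using n(3) w by (simp add: w_def)
    qed
  qed
  moreover have "g z = s z" if "norm (z - 1/2) \<le> 1/4" for z
  proof -
    have "1/4 \<le> norm z" "norm z \<le> 3/4"
      using that norm_triangle_ineq2[of "1/2" "1/2 - z"] norm_triangle_ineq[of "1/2" "z - 1/2"]
      by (auto simp: norm_minus_commute)
    then have "G (Suc n) z = s z" for n
      using norm_trap_less[of z] by (intro step_seed) auto
    moreover obtain n where "G (Suc n) z = g z"
      using ev(1)[of z, THEN eventually_sequentially_Suc[THEN iffD2]] by (auto simp: eventually_sequentially)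
    ultimately show ?thesis by simp
  qed
  ultimately show ?thesis by (intro exI[of _ g]) (auto simp: fun_eq_iff)
qed

end

section \<open>A one-parameter family of seeds\<close>

text \<open>Squaring removes the corner of the positive part, so the square of
  \<open>pos_gap\<close> is differentiable across the edge of its support.\<close>

lemma has_real_derivative_positive_part_squared:
  "((\<lambda>x::real. (max 0 x)\<^sup>2) has_real_derivative 2 * max 0 x) (at x)"
proof -
  consider "x > 0" | "x < 0" | "x = 0" by linarith
  then show ?thesis
  proof cases
    case 1
    have "((\<lambda>x::real. x\<^sup>2) has_real_derivative 2 * max 0 x) (at x)"
      using 1 by (auto intro!: derivative_eq_intros)
    then show ?thesis
      by (rule has_field_derivative_transform_within_open[of _ _ _ "{0<..}"]) (use 1 in auto)
  next
    case 2
    have "((\<lambda>x::real. 0) has_real_derivative 2 * max 0 x) (at x)"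
      using 2 by auto
    then show ?thesis
      by (rule has_field_derivative_transform_within_open[of _ _ _ "{..<0}"]) (use 2 in auto)
  next
    case 3
    have "((\<lambda>h::real. (max 0 h)\<^sup>2 / h) \<longlongrightarrow> 0) (at 0)"
    proof (rule Lim_null_comparison)
      show "\<forall>\<^sub>F h in at (0::real). norm ((max 0 h)\<^sup>2 / h) \<le> \<bar>h\<bar>"
        by (rule always_eventually) (auto simp: max_def power2_eq_square)
      show "((\<lambda>h::real. \<bar>h\<bar>) \<longlongrightarrow> 0) (at 0)"
        by (auto intro!: tendsto_eq_intros)
    qed
    then show ?thesis using 3 by (simp add: has_field_derivative_iff)
  qed
qed

definition pos_gap :: "complex \<Rightarrow> real" where
  "pos_gap c = max 0 (1/16 - (norm c)\<^sup>2)"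

lemma pos_gap_eq_0: "norm c \<ge> 1/4 \<Longrightarrow> pos_gap c = 0"
  using power_mono[of "1/4" "norm c" 2] by (simp add: pos_gap_def power2_eq_square)

lemma pos_gap_bounds: "0 \<le> pos_gap c" "pos_gap c \<le> 1/16"
  using zero_le_power2[of "norm c"] unfolding pos_gap_def by linarith+

text \<open>A real bump of height at most \<open>1/256\<close> is added to the identity. Its support
  lies in \<open>norm z \<ge> 1/4\<close>, which is what \<open>s_near\<close> requires, and its
  derivative terms are at most \<open>1/32\<close>.\<close>

lemma perturbation_bump:
  fixes t :: real
  assumes t: "0 < t" "t < 1"
  shows "perturbation (\<lambda>z. z + of_real (t * (pos_gap (z - 1/2))\<^sup>2))
    (\<lambda>z. 1 - of_real (2 * t * pos_gap (z - 1/2)) * cnj (z - 1/2))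
    (\<lambda>z. - of_real (2 * t * pos_gap (z - 1/2)) * (z - 1/2))"
proof
  fix z :: complex
  define c where "c = z - 1/2"
  have "((\<lambda>z::complex. 1/16 - (norm (z - 1/2))\<^sup>2) has_derivative (\<lambda>v. - (2 * (c \<bullet> v)))) (at z)"
    unfolding power2_norm_eq_inner c_def by (auto intro!: derivative_eq_intros simp: inner_commute)
  from has_derivative_compose[OF this
      has_real_derivative_positive_part_squared[THEN has_field_derivative_imp_has_derivative]]
  have "((\<lambda>z. (pos_gap (z - 1/2))\<^sup>2) has_derivative (\<lambda>v. 2 * pos_gap c * - (2 * (c \<bullet> v)))) (at z)"
    by (simp add: pos_gap_def c_def)
  then have "((\<lambda>z. z + complex_of_real (t * (pos_gap (z - 1/2))\<^sup>2)) has_derivative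
      (\<lambda>v. v + of_real (t * (2 * pos_gap c * - (2 * (c \<bullet> v)))))) (at z)"
    by (intro has_derivative_add has_derivative_ident has_derivative_of_real has_derivative_mult_right)
  \<comment> \<open>Twice the real inner product \<open>c \<bullet> v\<close> equals
    \<open>cnj c * v + c * cnj v\<close>, which separates the two complex derivatives.\<close>
  moreover have "v + of_real (t * (2 * pos_gap c * - (2 * (c \<bullet> v))))
      = (1 - of_real (2 * t * pos_gap c) * cnj c) * v + - of_real (2 * t * pos_gap c) * c * cnj v" for v
    by (simp add: complex_eq_iff inner_complex_def algebra_simps)
  ultimately show "((\<lambda>z. z + complex_of_real (t * (pos_gap (z - 1/2))\<^sup>2)) has_derivative
      (\<lambda>v. (1 - of_real (2 * t * pos_gap (z - 1/2)) * cnj (z - 1/2)) * v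
        + - of_real (2 * t * pos_gap (z - 1/2)) * (z - 1/2) * cnj v)) (at z)"
    by (simp only: c_def)
  show "z + of_real (t * (pos_gap (z - 1/2))\<^sup>2) = z" if "norm (z - 1/2) > 1/4"
    using that pos_gap_eq_0[of "z - 1/2"] by simp
  show "norm (z + of_real (t * (pos_gap (z - 1/2))\<^sup>2) - z) \<le> norm z / 64"
  proof (cases "norm c \<ge> 1/4")
    case True
    then show ?thesis by (simp add: pos_gap_eq_0 flip: c_def)
  next
    case False
    then have "norm z \<ge> 1/4"
      using norm_triangle_ineq3[of "1/2" "z"] by (simp add: c_def norm_minus_commute)
    moreover have "t * (pos_gap c)\<^sup>2 \<le> 1 * (1/16)\<^sup>2"
      using t pos_gap_bounds by (intro mult_mono power_mono) auto
    ultimately show ?thesis using t by (simp add: norm_mult power2_eq_square flip: c_def)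
  qed
  have "pos_gap c * norm c \<le> 1/64"
  proof (cases "norm c \<ge> 1/4")
    case False
    then show ?thesis using mult_mono[OF pos_gap_bounds(2)[of c], of "norm c" "1/4"] by simp
  qed (simp add: pos_gap_eq_0)
  \<comment> \<open>On the support the two factors are at most \<open>1/16\<close> and
    \<open>1/4\<close>.\<close>
  then have "t * (pos_gap c * norm c) \<le> 1 * (1/64)"
    using t pos_gap_bounds by (intro mult_mono) auto
  then have b: "norm (of_real (2 * t * pos_gap c) * c) \<le> 1/32"
    using t pos_gap_bounds(1)[of c] by (simp add: norm_mult abs_mult)
  then have b': "norm (of_real (2 * t * pos_gap c) * cnj c) \<le> 1/32"
    by (simp only: norm_mult complex_mod_cnj)
  have "norm (1 - of_real (2 * t * pos_gap c) * cnj c) \<le> 3/2"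
    using norm_triangle_ineq4[of 1 "of_real (2 * t * pos_gap c) * cnj c"] b' by simp
  then show "norm (1 - of_real (2 * t * pos_gap (z - 1/2)) * cnj (z - 1/2)) \<le> 3/2"
    by (simp only: c_def)
  have "norm (1 - of_real (2 * t * pos_gap c) * cnj c) \<ge> 1 - 1/32"
    using norm_triangle_ineq2[of 1 "of_real (2 * t * pos_gap c) * cnj c"] b' norm_one[where 'a = complex] by linarith
  then have "norm (- of_real (2 * t * pos_gap c) * c) \<le> norm (1 - of_real (2 * t * pos_gap c) * cnj c) / 2"
    using b by (simp only: mult_minus_left norm_minus_cancel)
  then show "norm (- of_real (2 * t * pos_gap (z - 1/2)) * (z - 1/2))
      \<le> norm (1 - of_real (2 * t * pos_gap (z - 1/2)) * cnj (z - 1/2)) / 2"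
    by (simp only: c_def)
qed

section \<open>Transcendence and uncountability\<close>

text \<open>Periodicity would give the polynomial \<open>p - [:shifted_exp 0:]\<close> infinitely
  many zeros, hence make \<open>p\<close> constant, but the moduli at \<open>0\<close> and
  \<open>5\<close> differ.\<close>

lemma transcendental_entire_shifted_exp: "transcendental_entire shifted_exp"
  unfolding transcendental_entire_def
proof
  show "shifted_exp holomorphic_on UNIV"
    unfolding shifted_exp_def by (intro holomorphic_intros)
  show "\<not> (\<exists>p. \<forall>z. shifted_exp z = poly p z)"
  proof
    assume "\<exists>p. \<forall>z. shifted_exp z = poly p z"
    then obtain p where p: "\<And>z. shifted_exp z = poly p z" by blast
    define q where "q = p - [:shifted_exp 0:]"
    have "range (\<lambda>n. of_nat n * (2 * of_real pi * \<i>)) \<subseteq> {z. poly q z = 0}"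
      by (auto simp: q_def simp flip: p)
         (simp add: shifted_exp_def exp_diff exp_minus exp_of_nat_mult field_simps)
    moreover have "infinite (range (\<lambda>n. of_nat n * (2 * of_real pi * \<i>)))"
      by (rule range_inj_infinite) (auto simp: inj_def)
    ultimately have "q = 0"
      using poly_roots_finite finite_subset by blast
    then have "poly p 5 = poly [:shifted_exp 0:] 5"
      by (simp only: q_def right_minus_eq)
    then have "shifted_exp 5 = shifted_exp 0"
      by (simp add: p)
    then have "norm (shifted_exp 5) = norm (shifted_exp 0)" by simp
    then show False by (simp add: shifted_exp_def)
  qed
qed

theorem theorem1p6:
  shows "\<exists>f. transcendental_entire f \<and>
           uncountable {g. quasiregular g \<and> f \<circ> g = g \<circ> f}"
proof (intro exI conjI)
  show "transcendental_entire shifted_exp"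
    by (rule transcendental_entire_shifted_exp)
  \<comment> \<open>At the centre \<open>1/2\<close> of the bump, \<open>pos_gap\<close> equals
    \<open>1/16\<close>, so the value of \<open>g\<close> there recovers the parameter
    \<open>t\<close>.\<close>
  have "\<exists>g. quasiregular g \<and> shifted_exp \<circ> g = g \<circ> shifted_exp \<and> g (1/2) = 1/2 + of_real (t * (1/16)\<^sup>2)"
    if "t \<in> {0<..<1}" for t :: real
    using perturbation.commuting_quasiregular_extension[OF perturbation_bump, of t] that
    by (auto simp: pos_gap_def dest!: spec[of _ "1/2"])
  then obtain g where g: "\<And>t::real. t \<in> {0<..<1} \<Longrightarrow> quasiregular (g t) \<and> shifted_exp \<circ> g t = g t \<circ> shifted_exp
      \<and> g t (1/2) = 1/2 + of_real (t * (1/16)\<^sup>2)"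
    by metis
  have "inj_on g {0<..<1}"
  proof (rule inj_onI)
    fix t u :: real assume "t \<in> {0<..<1}" "u \<in> {0<..<1}" "g t = g u"
    then have "1/2 + complex_of_real (t * (1/16)\<^sup>2) = 1/2 + of_real (u * (1/16)\<^sup>2)"
      using g by metis
    then show "t = u" by (simp del: of_real_mult)
  qed
  then have "uncountable (g ` {0<..<1})"
    by (metis countable_image_inj_on uncountable_open_interval zero_less_one)
  moreover have "g ` {0<..<1} \<subseteq> {g. quasiregular g \<and> shifted_exp \<circ> g = g \<circ> shifted_exp}"
    using g by blast
  ultimately show "uncountable {g. quasiregular g \<and> shifted_exp \<circ> g = g \<circ> shifted_exp}"
    using countable_subset by blast
qed

end
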